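(* Let $\mathsf T$ and $\mathsf T'$ be two (possibly distinct) trees on node set $\mathcal V=\{1,\dots,p\}$. Let $P$ be a zero-field Ising model on $\mathsf T$ and $Q$ a zero-field Ising model on $\mathsf T'$ such that $\mathcal L^{(2)}(P,Q)<\eta$. Then for all $k$, $\mathcal L^{(k)}(P,Q)<k2^k\eta$.
   Context: For a tree $\mathsf T=(\mathcal V,\mathcal E)$, a zero-field Ising model on $\mathsf T$ is a distribution on $\{-1,+1\}^p$ of the form $P(x)=\exp\big(\sum_{(i,j)\in\mathcal E}\theta_{ij}x_ix_j-\Phi(\theta)\big)$ with $\theta_{ij}\in\mathbb R$ and $\Phi(\theta)$ the normalizing constant. For distributions $P,Q$ on $\{-1,+1\}^p$ and $1\le k\le p$, $\mathcal L^{(k)}(P,Q)=\max_{\mathcal S\subseteq\mathcal V:|\mathcal S|=k}d_{\mathrm{TV}}(P_{\mathcal S},Q_{\mathcal S})$, where $P_{\mathcal S}$ is the marginal on the coordinates in $\mathcal S$ and $d_{\mathrm{TV}}$ is total variation distance (half the $\ell_1$ distance). *)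

theory Defs
  imports "HOL-Probability.Probability"
begin

text \<open>An undirected simple graph is a vertex set together with a set of two-element edges.\<close>

definition simple_graph :: "'v set \<Rightarrow> 'v set set \<Rightarrow> bool" where
  "simple_graph V E \<longleftrightarrow> finite V \<and> (\<forall>e\<in>E. e \<subseteq> V \<and> card e = 2)"

definition graph_connected :: "'v set \<Rightarrow> 'v set set \<Rightarrow> bool" where
  "graph_connected V E \<longleftrightarrow> V \<noteq> {} \<and> (\<forall>u\<in>V. \<forall>v\<in>V. (u, v) \<in> {(a, b). {a, b} \<in> E}\<^sup>*)"

text \<open>The closing edge from the last vertex back to the first is the case \<open>i = length vs - 1\<close>.\<close>

definition graph_cycle :: "'v set set \<Rightarrow> 'v list \<Rightarrow> bool" where
  "graph_cycle E vs \<longleftrightarrow>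
     length vs \<ge> 3 \<and> distinct vs \<and>
     (\<forall>i<length vs. {vs ! i, vs ! (Suc i mod length vs)} \<in> E)"

definition is_tree :: "'v set \<Rightarrow> 'v set set \<Rightarrow> bool" where
  "is_tree V E \<longleftrightarrow> simple_graph V E \<and> graph_connected V E \<and> (\<nexists>vs. graph_cycle E vs)"

text \<open>
  Configurations in \<open>{-1,+1}\<^sup>V\<close> are extensional functions (\<open>undefined\<close> outside \<open>V\<close>), so that
  each of them is represented exactly once.
\<close>

definition spins :: "'v set \<Rightarrow> ('v \<Rightarrow> real) set" where
  "spins V = V \<rightarrow>\<^sub>E {-1, 1}"

text \<open>
  The parameter \<open>\<theta>\<close> is indexed by unordered edges. For an edge \<open>e = {i, j}\<close> with
  \<open>i \<noteq> j\<close>, the product over \<open>e\<close> is \<open>x\<^sub>i x\<^sub>j\<close>.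
\<close>

definition ising_energy :: "'v set set \<Rightarrow> ('v set \<Rightarrow> real) \<Rightarrow> ('v \<Rightarrow> real) \<Rightarrow> real" where
  "ising_energy E \<theta> x = (\<Sum>e\<in>E. \<theta> e * (\<Prod>i\<in>e. x i))"

definition log_partition :: "'v set \<Rightarrow> 'v set set \<Rightarrow> ('v set \<Rightarrow> real) \<Rightarrow> real" where
  "log_partition V E \<theta> = ln (\<Sum>x\<in>spins V. exp (ising_energy E \<theta> x))"

definition zero_field_ising :: "'v set \<Rightarrow> 'v set set \<Rightarrow> ('v \<Rightarrow> real) pmf \<Rightarrow> bool" where
  "zero_field_ising V E P \<longleftrightarrow>
     set_pmf P \<subseteq> spins V \<and>
     (\<exists>\<theta>. \<forall>x\<in>spins V. pmf P x = exp (ising_energy E \<theta> x - log_partition V E \<theta>))"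

definition marginal :: "'v set \<Rightarrow> ('v \<Rightarrow> real) pmf \<Rightarrow> ('v \<Rightarrow> real) pmf" where
  "marginal S P = map_pmf (\<lambda>x. restrict x S) P"

definition tv_dist :: "'a pmf \<Rightarrow> 'a pmf \<Rightarrow> real" where
  "tv_dist P Q = (\<Sum>\<^sub>\<infinity>z. \<bar>pmf P z - pmf Q z\<bar>) / 2"

text \<open>Only meaningful for finite \<open>V\<close> and \<open>k \<le> card V\<close>; otherwise the maximum is not
  taken over a finite nonempty set.\<close>

definition local_tv :: "'v set \<Rightarrow> nat \<Rightarrow> ('v \<Rightarrow> real) pmf \<Rightarrow> ('v \<Rightarrow> real) pmf \<Rightarrow> real" where
  "local_tv V k P Q =
     Max ((\<lambda>S. tv_dist (marginal S P) (marginal S Q)) ` {S. S \<subseteq> V \<and> card S = k})"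

end

theory Submission
  imports Defs
begin

text \<open>
  Write \<open>x\<^sub>A\<close> for the product of the spins in \<open>A\<close>. Both sides of the inequality can be expressed
  by the correlations \<open>E[x\<^sub>A]\<close>. By Fourier inversion on the cube, \<open>2 d\<^sub>T\<^sub>V(P\<^sub>S, Q\<^sub>S)\<close> is at most the
  sum of \<open>\<bar>E\<^sub>P[x\<^sub>A] - E\<^sub>Q[x\<^sub>A]\<bar>\<close> over \<open>A \<subseteq> S\<close> (\<open>tv_dist_le_moment_diffs\<close>), and conversely the pair
  correlations of \<open>P\<close> and \<open>Q\<close> differ by at most \<open>2 L\<close> where \<open>L = \<L>\<^sup>(\<^sup>2\<^sup>)(P, Q)\<close>
  (\<open>moment_diff_le_tv_dist\<close>). It therefore suffices to control all correlations by the pair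
  correlations, with a loss that is linear in \<open>card A\<close> (\<open>forest_moments_diff_le\<close>).

  For a zero-field model on a tree, \<open>E[x\<^sub>A]\<close> vanishes for odd \<open>A\<close>. For even \<open>A\<close> it is the product of
  the edge correlations over the edges that separate \<open>A\<close> into two odd parts. Two facts follow.
  Some partition of \<open>A\<close> into pairs, joined by edge-disjoint paths, gives \<open>E[x\<^sub>A]\<close> as the product of
  its pair correlations (\<open>forest_moments_exact_pairing\<close>). The paths of any other partition
  into pairs cover each of these edges an odd number of times and every other edge an even number
  of times, so its product is \<open>c E[x\<^sub>A]\<close> with \<open>0 \<le> c \<le> 1\<close> (\<open>forest_moments_prod_disjoint\<close>).

  The trees of \<open>P\<close> and \<open>Q\<close> may have different optimal pairings. Take the pairing that is exact for
  \<open>P\<close> and use it for \<open>Q\<close> as well: the two products differ by at most \<open>card A / 2 \<cdot> 2 L\<close>, hence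
  \<open>E\<^sub>P[x\<^sub>A]\<close> is within \<open>card A \<cdot> L\<close> of a fraction of \<open>E\<^sub>Q[x\<^sub>A]\<close>. The same holds with the roles
  exchanged, and two numbers each of which is \<open>\<delta>\<close>-close to a fraction of the other are
  \<open>2 \<delta>\<close>-close (\<open>abs_diff_le_if_near_fractions\<close>). Summing \<open>2 k L\<close> over the \<open>2\<^sup>k\<close> subsets of a
  \<open>k\<close>-set gives the theorem.
\<close>

section \<open>Correlation functions of forests\<close>

text \<open>
  The correlation functions \<open>A \<mapsto> E[x\<^sub>A]\<close> of zero-field Ising models on forests, built up leaf by
  leaf. If \<open>l\<close> is attached to \<open>n\<close> with edge correlation \<open>t\<close>, then \<open>x\<^sub>l\<close> equals \<open>x\<^sub>n\<close> times an
  independent sign of mean \<open>t\<close>; so \<open>l\<close> may be replaced by \<open>n\<close> at the cost of a factor \<open>t\<close>, and if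
  \<open>n\<close> already occurs, the two copies of \<open>x\<^sub>n\<close> cancel. This recursion carries every
  property of tree models that the comparison uses and keeps graphs out of the algebra.
\<close>

inductive forest_moments :: "('v set \<Rightarrow> real) \<Rightarrow> bool" where
  edgeless: "forest_moments (\<lambda>A. if A = {} then 1 else 0)"
| attach: "\<lbrakk>forest_moments m; l \<noteq> n; \<bar>t\<bar> \<le> 1\<rbrakk>
    \<Longrightarrow> forest_moments (\<lambda>A. if l \<in> A then t * m (sym_diff A {l, n}) else m A)"

lemma forest_moments_empty: "forest_moments m \<Longrightarrow> m {} = 1"
  by (induction rule: forest_moments.induct) auto

lemma forest_moments_abs_le_1: "forest_moments m \<Longrightarrow> \<bar>m A\<bar> \<le> 1"
proof (induction arbitrary: A rule: forest_moments.induct)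
  case (attach m l n t)
  have "\<bar>t * m (sym_diff A {l, n})\<bar> \<le> 1 * 1"
    unfolding abs_mult using attach by (intro mult_mono) auto
  then show ?case using attach.IH by (cases "l \<in> A") (simp_all only: if_True if_False)
qed simp

lemma even_card_sym_diff_pair:
  assumes "l \<noteq> n" "l \<in> A"
  shows "even (card (sym_diff A {l, n})) \<longleftrightarrow> even (card A)"
proof (cases "finite A")
  case fin: True
  show ?thesis
  proof (cases "n \<in> A")
    case True
    then have "sym_diff A {l, n} = A - {l} - {n}" using assms by auto
    moreover have "card (A - {l}) = card A - 1" "card (A - {l} - {n}) = card (A - {l}) - 1"
      using assms True by auto
    moreover have "card {l, n} \<le> card A"
      using fin True assms by (intro card_mono) auto
    ultimately show ?thesis using assms by auto
  next
    case False
    then have "sym_diff A {l, n} = insert n (A - {l})" using assms by auto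
    moreover have "card (insert n (A - {l})) = Suc (card (A - {l}))"
      using fin False by auto
    moreover have "Suc (card (A - {l})) = card A" using fin assms by (metis card_Suc_Diff1)
    ultimately show ?thesis by simp
  qed
next
  case False
  then have "infinite (A - {l, n})" by simp
  then have "infinite (sym_diff A {l, n})" by (metis finite_Un)
  with False show ?thesis by simp
qed

lemma forest_moments_odd: "forest_moments m \<Longrightarrow> odd (card A) \<Longrightarrow> m A = 0"
proof (induction arbitrary: A rule: forest_moments.induct)
  case (attach m l n t)
  then show ?case using even_card_sym_diff_pair[of l n A] by simp
qed auto

text \<open>
  In terms of separating edges: the edges of \<open>sym_diff A B\<close> are those that separate exactly one of
  \<open>A\<close> and \<open>B\<close> oddly, so the product on the left contains in addition the squares of the
  correlations of the common edges. These squares are the factor \<open>c\<close>.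
\<close>
lemma forest_moments_mult:
  assumes "forest_moments m"
  shows "\<exists>c. 0 \<le> c \<and> c \<le> 1 \<and> m A * m B = c * m (sym_diff A B)"
  using assms
proof (induction arbitrary: A B rule: forest_moments.induct)
  case edgeless
  then show ?case by (intro exI[of _ "if A = {} \<and> B = {} then 1 else 0"]) auto
next
  case (attach m l n t)
  let ?e = "{l, n}"
  consider "l \<in> A" "l \<in> B" | "l \<in> A" "l \<notin> B" | "l \<notin> A" "l \<in> B" | "l \<notin> A" "l \<notin> B"
    by blast
  then show ?case
  proof cases
    case 1
    have *: "sym_diff (sym_diff A ?e) (sym_diff B ?e) = sym_diff A B" by auto
    obtain c where "0 \<le> c" "c \<le> 1"
      and c: "m (sym_diff A ?e) * m (sym_diff B ?e) = c * m (sym_diff A B)"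
      using attach.IH[of "sym_diff A ?e" "sym_diff B ?e"] unfolding * by blast
    have "t\<^sup>2 \<le> 1" using attach.hyps by (simp add: abs_square_le_1)
    then have "t\<^sup>2 * c \<le> 1 * 1" using \<open>0 \<le> c\<close> \<open>c \<le> 1\<close> by (intro mult_mono) auto
    moreover have "t * m (sym_diff A ?e) * (t * m (sym_diff B ?e)) = t\<^sup>2 * c * m (sym_diff A B)"
      using c by (simp add: power2_eq_square algebra_simps)
    ultimately show ?thesis using 1 \<open>0 \<le> c\<close>
      by (intro exI[of _ "t\<^sup>2 * c"]) auto
  next
    case 2
    have *: "sym_diff (sym_diff A ?e) B = sym_diff (sym_diff A B) ?e" by auto
    show ?thesis using attach.IH[of "sym_diff A ?e" B] 2 unfolding *
      by (auto simp: algebra_simps)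
  next
    case 3
    have *: "sym_diff A (sym_diff B ?e) = sym_diff (sym_diff A B) ?e" by auto
    show ?thesis using attach.IH[of A "sym_diff B ?e"] 3 unfolding *
      by (auto simp: algebra_simps)
  next
    case 4
    then show ?thesis using attach.IH[of A B] by auto
  qed
qed

text \<open>
  The separating edges of \<open>A\<close> form a forest whose odd vertices are exactly \<open>A\<close>; a path between two
  of its leaves can be removed. The recursion finds such a path: it starts as an edge \<open>{l, n}\<close> with
  both ends in the set, and later grows by one edge when a leaf of the set is attached to one of its
  ends.
\<close>
lemma forest_moments_split_pair:
  assumes "forest_moments m" "finite A" "even (card A)" "A \<noteq> {}"
  shows "\<exists>u\<in>A. \<exists>v\<in>A. u \<noteq> v \<and> m A = m {u, v} * m (A - {u, v})"
  using assms
proof (induction arbitrary: A rule: forest_moments.induct)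
  case edgeless
  have "card A \<noteq> 1" "card A \<noteq> 0" using edgeless by auto
  then have "\<not> is_singleton A" by (simp add: is_singleton_altdef)
  then obtain u v where "u \<in> A" "v \<in> A" "u \<noteq> v"
    using edgeless by (metis all_not_in_conv is_singletonI')
  then show ?case using \<open>A \<noteq> {}\<close> by (intro bexI[of _ u] bexI[of _ v]) auto
next
  case (attach m l n t)
  let ?e = "{l, n}"
  let ?m = "\<lambda>A. if l \<in> A then t * m (sym_diff A ?e) else m A"
  show ?case
  proof (cases "l \<in> A")
    case False
    then obtain u v where "u \<in> A" "v \<in> A" "u \<noteq> v" "m A = m {u, v} * m (A - {u, v})"
      using attach.IH[of A] attach.prems by blast
    then show ?thesis using False by (intro bexI[of _ u] bexI[of _ v]) auto
  next
    case l: True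
    show ?thesis
    proof (cases "n \<in> A")
      case True
      have "sym_diff ?e ?e = {}" "sym_diff A ?e = A - ?e" using l True by auto
      moreover have "m {} = 1" using attach.hyps forest_moments_empty by blast
      ultimately show ?thesis using l True attach.hyps
        by (intro bexI[of _ l] bexI[of _ n]) auto
    next
      case n: False
      let ?A' = "sym_diff A ?e"
      have A': "?A' = insert n (A - {l})" using l n by auto
      have "even (card ?A')" using even_card_sym_diff_pair[of l n A] attach l by simp
      then obtain u v where uv: "u \<in> ?A'" "v \<in> ?A'" "u \<noteq> v"
          "m ?A' = m {u, v} * m (?A' - {u, v})"
        using attach.IH[of ?A'] attach.prems A' by (metis finite_Diff finite_insert insert_not_empty)
      have A: "?m A = t * (m {u, v} * m (?A' - {u, v}))" using l uv(4) by simp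
      show ?thesis
      proof (cases "n \<in> {u, v}")
        case False
        then have in_A: "u \<in> A" "v \<in> A" "u \<noteq> l" "v \<noteq> l" using uv A' attach.hyps by auto
        have "sym_diff (A - {u, v}) ?e = ?A' - {u, v}" using in_A False by auto
        then have "?m (A - {u, v}) = t * m (?A' - {u, v})" "?m {u, v} = m {u, v}"
          using l in_A by auto
        then show ?thesis using A in_A uv(3) by (intro bexI[of _ u] bexI[of _ v]) auto
      next
        case True
        \<comment> \<open>The pair that contains \<open>n\<close> is extended along the edge to \<open>l\<close>.\<close>
        then obtain w where w: "{u, v} = {n, w}" "w \<noteq> n" "w \<in> ?A'" using uv by auto
        then have in_A: "w \<in> A" "w \<noteq> l" using A' attach.hyps by auto
        have "sym_diff {l, w} ?e = {n, w}" "?A' - {n, w} = A - {l, w}"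
          using in_A w n attach.hyps A' by auto
        then have "?m {l, w} = t * m {u, v}" "?m (A - {l, w}) = m (?A' - {u, v})"
          using w by auto
        then show ?thesis using A in_A l by (intro bexI[of _ l] bexI[of _ w]) auto
      qed
    qed
  qed
qed

section \<open>Pairings\<close>
definition pairing :: "'v set \<Rightarrow> 'v set set \<Rightarrow> bool" where
  "pairing A \<pi> \<longleftrightarrow> finite \<pi> \<and> disjoint \<pi> \<and> \<Union>\<pi> = A \<and> (\<forall>B\<in>\<pi>. card B = 2)"

lemma card_pairing:
  assumes "pairing A \<pi>"
  shows "card A = 2 * card \<pi>"
proof -
  have "card (\<Union>\<pi>) = sum card \<pi>"
    using assms by (intro card_Union_disjoint) (auto simp: pairing_def intro: card_ge_0_finite)
  then show ?thesis using assms by (simp add: pairing_def)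
qed

lemma forest_moments_exact_pairing:
  assumes "forest_moments m" "finite A" "even (card A)"
  shows "\<exists>\<pi>. pairing A \<pi> \<and> m A = (\<Prod>B\<in>\<pi>. m B)"
  using assms(2,3)
proof (induction A rule: finite_psubset_induct)
  case (psubset A)
  show ?case
  proof (cases "A = {}")
    case True
    then show ?thesis using forest_moments_empty[OF assms(1)]
      by (intro exI[of _ "{}"]) (simp add: pairing_def)
  next
    case False
    then obtain u v where uv: "u \<in> A" "v \<in> A" "u \<noteq> v" "m A = m {u, v} * m (A - {u, v})"
      using forest_moments_split_pair[OF assms(1)] psubset by meson
    have "even (card (A - {u, v}))"
      using uv psubset.prems psubset.hyps by (simp add: card_Diff_subset)
    then obtain \<pi> where \<pi>: "pairing (A - {u, v}) \<pi>" "m (A - {u, v}) = (\<Prod>B\<in>\<pi>. m B)"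
      using psubset.IH[of "A - {u, v}"] uv by blast
    have "{u, v} \<notin> \<pi>" using \<pi> by (auto simp: pairing_def)
    moreover have "pairing A (insert {u, v} \<pi>)"
      using \<pi>(1) uv by (auto simp: pairing_def pairwise_insert disjnt_def)
    ultimately show ?thesis using \<pi> uv
      by (intro exI[of _ "insert {u, v} \<pi>"]) (auto simp: pairing_def)
  qed
qed

lemma forest_moments_prod_disjoint:
  assumes "forest_moments m" "finite \<pi>" "disjoint \<pi>"
  shows "\<exists>c. 0 \<le> c \<and> c \<le> 1 \<and> (\<Prod>B\<in>\<pi>. m B) = c * m (\<Union>\<pi>)"
  using assms(2,3)
proof (induction \<pi> rule: finite_induct)
  case empty
  then show ?case using forest_moments_empty[OF assms(1)] by (intro exI[of _ 1]) simp
next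
  case (insert B \<pi>)
  have "B \<inter> \<Union>\<pi> = {}"
    using insert.prems insert.hyps by (fastforce simp: pairwise_insert disjnt_def)
  then have *: "sym_diff B (\<Union>\<pi>) = \<Union>(insert B \<pi>)" by auto
  obtain c where c: "0 \<le> c" "c \<le> 1" "(\<Prod>B\<in>\<pi>. m B) = c * m (\<Union>\<pi>)"
    using insert by (auto simp: pairwise_insert)
  obtain d where d: "0 \<le> d" "d \<le> 1" "m B * m (\<Union>\<pi>) = d * m (\<Union>(insert B \<pi>))"
    using forest_moments_mult[OF assms(1), of B "\<Union>\<pi>"] unfolding * by blast
  have "c * d \<le> 1 * 1" using c d by (intro mult_mono) auto
  moreover have "(\<Prod>B\<in>insert B \<pi>. m B) = c * d * m (\<Union>(insert B \<pi>))"
    using insert.hyps c(3) d(3) by (simp add: algebra_simps)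
  ultimately show ?case using c d by (intro exI[of _ "c * d"]) auto
qed

text \<open>
  The pairing that is exact for \<open>m\<close> is evaluated in both models. For \<open>m'\<close> it yields only a
  fraction of \<open>m' A\<close>, since the forest of \<open>m'\<close> may prefer another pairing.
\<close>
lemma forest_moments_near_fraction:
  assumes "forest_moments m" "forest_moments m'" "finite A" "even (card A)"
    and close: "\<And>u v. \<lbrakk>u \<in> A; v \<in> A; u \<noteq> v\<rbrakk> \<Longrightarrow> \<bar>m {u, v} - m' {u, v}\<bar> \<le> \<epsilon>"
  shows "\<exists>c. 0 \<le> c \<and> c \<le> 1 \<and> \<bar>m A - c * m' A\<bar> \<le> real (card A) / 2 * \<epsilon>"
proof -
  obtain \<pi> where \<pi>: "pairing A \<pi>" "m A = (\<Prod>B\<in>\<pi>. m B)"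
    using forest_moments_exact_pairing[OF assms(1,3,4)] by blast
  obtain c where c: "0 \<le> c" "c \<le> 1" "(\<Prod>B\<in>\<pi>. m' B) = c * m' A"
    using forest_moments_prod_disjoint[OF assms(2), of \<pi>] \<pi>(1) by (auto simp: pairing_def)
  have "\<bar>(\<Prod>B\<in>\<pi>. m B) - (\<Prod>B\<in>\<pi>. m' B)\<bar> \<le> (\<Sum>B\<in>\<pi>. \<bar>m B - m' B\<bar>)"
    using norm_prod_diff[of \<pi> m m'] forest_moments_abs_le_1[OF assms(1)]
      forest_moments_abs_le_1[OF assms(2)] by simp
  also have "\<dots> \<le> (\<Sum>B\<in>\<pi>. \<epsilon>)"
  proof (intro sum_mono)
    fix B assume "B \<in> \<pi>"
    then have "card B = 2" "B \<subseteq> A" using \<pi>(1) by (auto simp: pairing_def)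
    then obtain u v where "B = {u, v}" "u \<noteq> v" "B \<subseteq> A" by (auto simp: card_2_iff)
    then show "\<bar>m B - m' B\<bar> \<le> \<epsilon>" using close by auto
  qed
  also have "\<dots> = real (card A) / 2 * \<epsilon>" using card_pairing[OF \<pi>(1)] by simp
  finally show ?thesis using \<pi>(2) c by metis
qed

text \<open>
  For equal signs \<open>\<delta>\<close> would do, since the number of larger absolute value is farther from any
  fraction of the other one than from that number itself. The factor \<open>2\<close> is for opposite signs, where each absolute
  value is at most \<open>\<delta>\<close>.
\<close>
lemma abs_diff_le_if_near_fractions:
  fixes a b :: real
  assumes "0 \<le> c" "c \<le> 1" "\<bar>a - c * b\<bar> \<le> \<delta>" and "0 \<le> c'" "c' \<le> 1" "\<bar>b - c' * a\<bar> \<le> \<delta>"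
  shows "\<bar>a - b\<bar> \<le> 2 * \<delta>"
proof -
  have "c * b \<le> max b 0" "min b 0 \<le> c * b"
    using assms by (auto simp: max_def min_def mult_left_le_one_le mult_nonneg_nonpos
        mult_le_cancel_right1)
  moreover have "c' * a \<le> max a 0" "min a 0 \<le> c' * a"
    using assms by (auto simp: max_def min_def mult_left_le_one_le mult_nonneg_nonpos
        mult_le_cancel_right1)
  ultimately show ?thesis using assms(3,6) unfolding max_def min_def by (smt (verit))
qed

text \<open>
  The forests of \<open>m\<close> and \<open>m'\<close> are unrelated, which is why the preceding two lemmas are used in
  both directions.
\<close>
lemma forest_moments_diff_le:
  assumes "forest_moments m" "forest_moments m'" "finite A" "0 \<le> \<epsilon>"
    and close: "\<And>u v. \<lbrakk>u \<in> A; v \<in> A; u \<noteq> v\<rbrakk> \<Longrightarrow> \<bar>m {u, v} - m' {u, v}\<bar> \<le> \<epsilon>"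
  shows "\<bar>m A - m' A\<bar> \<le> real (card A) * \<epsilon>"
proof (cases "even (card A)")
  case True
  have close': "\<And>u v. \<lbrakk>u \<in> A; v \<in> A; u \<noteq> v\<rbrakk> \<Longrightarrow> \<bar>m' {u, v} - m {u, v}\<bar> \<le> \<epsilon>"
    using close by (simp add: abs_minus_commute)
  obtain c where c: "0 \<le> c" "c \<le> 1" "\<bar>m A - c * m' A\<bar> \<le> real (card A) / 2 * \<epsilon>"
    using forest_moments_near_fraction[OF assms(1,2,3) True close] by blast
  obtain c' where c': "0 \<le> c'" "c' \<le> 1" "\<bar>m' A - c' * m A\<bar> \<le> real (card A) / 2 * \<epsilon>"
    using forest_moments_near_fraction[OF assms(2,1,3) True close'] by blast
  show ?thesis using abs_diff_le_if_near_fractions[OF c c'] by simp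
next
  case False
  then show ?thesis
    using forest_moments_odd[OF assms(1) False] forest_moments_odd[OF assms(2) False] assms(4) by simp
qed

section \<open>Zero-field Ising models\<close>

text \<open>
  The first vertex of a longest path is a leaf: a further neighbour off the path would extend it,
  and one on the path would close a cycle.
\<close>
lemma acyclic_graph_has_leaf:
  assumes "finite E" "E \<noteq> {}" "\<And>e. e \<in> E \<Longrightarrow> card e = 2" "\<nexists>vs. graph_cycle E vs"
  shows "\<exists>l n. l \<noteq> n \<and> {l, n} \<in> E \<and> l \<notin> \<Union>(E - {{l, n}})"
proof -
  define path where "path vs \<longleftrightarrow> 2 \<le> length vs \<and> distinct vs \<and>
      (\<forall>i. Suc i < length vs \<longrightarrow> {vs ! i, vs ! Suc i} \<in> E)" for vs
  have fin: "finite (\<Union>E)"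
    using assms(1,3) by (metis card.infinite finite_Union zero_neq_numeral)
  have bounded: "length vs < Suc (card (\<Union>E))" if "path vs" for vs
  proof -
    have "vs ! i \<in> \<Union>E" if "i < length vs" for i
    proof (cases "Suc i < length vs")
      case True
      then show ?thesis using \<open>path vs\<close> unfolding path_def by blast
    next
      case False
      then obtain j where "i = Suc j" using \<open>path vs\<close> that unfolding path_def by (cases i) auto
      then show ?thesis using \<open>path vs\<close> that unfolding path_def by blast
    qed
    then have "set vs \<subseteq> \<Union>E" by (metis in_set_conv_nth subsetI)
    then have "card (set vs) \<le> card (\<Union>E)" using fin by (rule card_mono[rotated])
    then show ?thesis using \<open>path vs\<close> by (simp add: path_def distinct_card)
  qed
  obtain u v where "{u, v} \<in> E" "u \<noteq> v" using assms(2,3) by (metis card_2_iff ex_in_conv)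
  then have "path [u, v]" by (simp add: path_def less_Suc_eq)
  then obtain vs where vs: "path vs" and longest: "\<And>ws. path ws \<Longrightarrow> length ws \<le> length vs"
    using ex_has_greatest_nat[of path _ length] bounded by blast
  define l n where "l = vs ! 0" and "n = vs ! 1"
  have "2 \<le> length vs" "distinct vs" "{vs ! 0, vs ! Suc 0} \<in> E"
    using vs by (auto simp: path_def)
  moreover from this have "l \<noteq> n" unfolding l_def n_def by (subst nth_eq_iff_index_eq) auto
  ultimately have ln: "l \<noteq> n" "{l, n} \<in> E" by (auto simp: l_def n_def)
  have "l \<notin> e" if e: "e \<in> E" "e \<noteq> {l, n}" for e
  proof
    assume "l \<in> e"
    then obtain w where w: "e = {l, w}" "w \<noteq> l" using assms(3)[OF e(1)] by (auto simp: card_2_iff)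
    show False
    proof (cases "w \<in> set vs")
      case False
      have "{(w # vs) ! i, (w # vs) ! Suc i} \<in> E" if "Suc i < length (w # vs)" for i
        using vs that w e by (cases i) (auto simp: path_def l_def insert_commute)
      then have "path (w # vs)" using vs False by (auto simp: path_def)
      then show False using longest by fastforce
    next
      case True
      then obtain j where j: "j < length vs" "vs ! j = w" by (meson in_set_conv_nth)
      have "j \<noteq> 0" "j \<noteq> 1" using j w e by (auto simp: l_def n_def)
      then have "2 \<le> j" by simp
      let ?c = "take (Suc j) vs"
      have len: "length ?c = Suc j" using j by simp
      have "{?c ! i, ?c ! (Suc i mod length ?c)} \<in> E" if i: "i < length ?c" for i
      proof (cases "i = j")
        case True
        then show ?thesis using len j w e by (simp add: l_def insert_commute)
      next
        case False
        then show ?thesis using len i vs j by (simp add: path_def)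
      qed
      then have "graph_cycle E ?c"
        using len \<open>2 \<le> j\<close> vs by (auto simp: graph_cycle_def path_def)
      then show False using assms(4) by blast
    qed
  qed
  then show ?thesis using ln by blast
qed

lemma finite_spins: "finite V \<Longrightarrow> finite (spins V)"
  by (simp add: spins_def finite_PiE)

lemma spins_square: "x \<in> spins V \<Longrightarrow> i \<in> V \<Longrightarrow> x i * x i = 1"
  by (auto simp: spins_def PiE_def Pi_def)

lemma prod_spins_sym_diff:
  assumes "x \<in> spins V" "finite V" "A \<subseteq> V" "B \<subseteq> V"
  shows "prod x A * prod x B = prod x (sym_diff A B)"
proof -
  have fin: "finite A" "finite B" using assms finite_subset by auto
  have A: "prod x A = prod x (A \<inter> B) * prod x (A - B)"
    using fin(1) by (rule prod.Int_Diff)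
  have B: "prod x B = prod x (A \<inter> B) * prod x (B - A)"
    using prod.Int_Diff[OF fin(2), of x A] by (simp add: Int_commute)
  have "prod x (A \<inter> B) * prod x (A \<inter> B) = (\<Prod>i\<in>A \<inter> B. x i * x i)" by (simp add: prod.distrib)
  also have "\<dots> = 1" using assms(3) spins_square[OF assms(1)] by (intro prod.neutral) auto
  finally have square: "prod x (A \<inter> B) * prod x (A \<inter> B) = 1" .
  have "prod x A * prod x B = prod x (A \<inter> B) * prod x (A \<inter> B) * (prod x (A - B) * prod x (B - A))"
    unfolding A B by (simp only: mult_ac)
  also have "\<dots> = prod x (A - B) * prod x (B - A)" unfolding square by simp
  also have "\<dots> = prod x (sym_diff A B)"
    using fin by (intro prod.union_disjoint[symmetric]) auto
  finally show ?thesis .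
qed

lemma abs_prod_spins:
  assumes "x \<in> spins V" "A \<subseteq> V"
  shows "\<bar>prod x A\<bar> = 1"
  unfolding abs_prod using assms
  by (intro prod.neutral) (auto simp: spins_def PiE_def Pi_def)

lemma sum_spins_prod:
  assumes "finite V" "A \<subseteq> V"
  shows "(\<Sum>x\<in>spins V. prod x A) = (if A = {} then 2 ^ card V else 0)"
proof -
  have "(\<Sum>x\<in>spins V. prod x A) = (\<Sum>x\<in>spins V. \<Prod>i\<in>V. if i \<in> A then x i else 1)"
    using assms by (intro sum.cong refl) (simp add: prod.If_cases Int_absorb1)
  also have "\<dots> = (\<Prod>i\<in>V. \<Sum>s\<in>{-1, 1 :: real}. if i \<in> A then s else 1)"
    unfolding spins_def using assms by (subst prod_sum_PiE) auto
  also have "\<dots> = (\<Prod>i\<in>V. if i \<in> A then 0 else 2)"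
    by (intro prod.cong) auto
  also have "\<dots> = (if A = {} then 2 ^ card V else 0)"
    using assms by (auto simp: prod_zero_iff)
  finally show ?thesis .
qed

text \<open>
  The weight \<open>\<Prod>(1 + t\<^sub>e x\<^sub>e)\<close> is the high-temperature form of the Gibbs weight. Splitting off the
  factor of an edge \<open>e = {l, n}\<close> gives \<open>m A + t\<^sub>e m (A \<triangle> e)\<close>, where \<open>m\<close> belongs to the other edges.
  If \<open>l\<close> is a leaf, no other edge contains it, and of the two sets \<open>A\<close> and \<open>A \<triangle> e\<close> the one that
  contains \<open>l\<close> has moment zero. What remains is the recursion of \<open>forest_moments\<close>. The vanishing of
  \<open>m\<close> on sets that contain an isolated vertex is part of the claim because the induction needs it.
\<close>
lemma forest_weight_moments:
  fixes t :: "'v set \<Rightarrow> real"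
  assumes "finite V" "finite E" "\<And>e. e \<in> E \<Longrightarrow> e \<subseteq> V \<and> card e = 2" "\<nexists>vs. graph_cycle E vs"
    and t: "\<And>e. \<bar>t e\<bar> \<le> 1"
  shows "\<exists>m. forest_moments m \<and> (\<forall>l A. l \<notin> \<Union>E \<longrightarrow> l \<in> A \<longrightarrow> m A = 0) \<and>
    (\<forall>A\<subseteq>V. (\<Sum>x\<in>spins V. prod x A * (\<Prod>e\<in>E. 1 + t e * prod x e)) = 2 ^ card V * m A)"
  using assms(2-4)
proof (induction E rule: finite_psubset_induct)
  case (psubset E)
  show ?case
  proof (cases "E = {}")
    case True
    have "(\<Sum>x\<in>spins V. prod x A * (\<Prod>e\<in>E. 1 + t e * prod x e)) =
        2 ^ card V * (if A = {} then 1 else 0)" if "A \<subseteq> V" for A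
      using sum_spins_prod[OF assms(1) that] True by simp
    then show ?thesis using forest_moments.edgeless
      by (intro exI[of _ "\<lambda>A. if A = {} then 1 else 0"] conjI) simp_all
  next
    case False
    have pairs: "\<And>e. e \<in> E \<Longrightarrow> card e = 2" using psubset.prems(1) by blast
    obtain l n where ln: "l \<noteq> n" "{l, n} \<in> E" "l \<notin> \<Union>(E - {{l, n}})"
      using acyclic_graph_has_leaf[OF psubset.hyps False pairs psubset.prems(2)] by blast
    define e where "e = {l, n}"
    define E' where "E' = E - {e}"
    have E: "E = insert e E'" "e \<notin> E'" "finite E'" and eV: "e \<subseteq> V"
      using ln(2) psubset.hyps psubset.prems(1)[OF ln(2)] unfolding e_def E'_def by auto
    have "graph_cycle E vs" if "graph_cycle E' vs" for vs
      using that by (auto simp: graph_cycle_def E(1))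
    then have acyclic: "\<nexists>vs. graph_cycle E' vs" using psubset.prems(2) by blast
    have "E' \<subset> E" and edges: "\<And>e. e \<in> E' \<Longrightarrow> e \<subseteq> V \<and> card e = 2"
      using E(1,2) psubset.prems(1) by auto
    obtain m where m: "forest_moments m" "\<And>l A. l \<notin> \<Union>E' \<Longrightarrow> l \<in> A \<Longrightarrow> m A = 0"
      and sum_m: "\<And>A. A \<subseteq> V \<Longrightarrow>
        (\<Sum>x\<in>spins V. prod x A * (\<Prod>e\<in>E'. 1 + t e * prod x e)) = 2 ^ card V * m A"
      using psubset.IH[OF \<open>E' \<subset> E\<close> edges acyclic] by blast
    have l: "l \<in> A \<Longrightarrow> m A = 0" for A using m(2) ln(3) by (auto simp: E'_def e_def)
    define m' where "m' A = (if l \<in> A then t e * m (sym_diff A e) else m A)" for A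
    have "forest_moments m'"
      unfolding m'_def e_def using m(1) ln(1) t by (rule forest_moments.attach)
    moreover have "m' A = 0" if "i \<notin> \<Union>E" "i \<in> A" for i A
      using that m(2)[of i] E by (auto simp: m'_def)
    moreover have "(\<Sum>x\<in>spins V. prod x A * (\<Prod>e\<in>E. 1 + t e * prod x e)) = 2 ^ card V * m' A"
      if A: "A \<subseteq> V" for A
    proof -
      have AeV: "sym_diff A e \<subseteq> V" using A eV by auto
      have "(\<Sum>x\<in>spins V. prod x A * (\<Prod>e\<in>E. 1 + t e * prod x e)) =
          (\<Sum>x\<in>spins V. prod x A * (\<Prod>e\<in>E'. 1 + t e * prod x e) +
            t e * (prod x (sym_diff A e) * (\<Prod>e\<in>E'. 1 + t e * prod x e)))"
      proof (intro sum.cong refl)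
        fix x assume "x \<in> spins V"
        then show "prod x A * (\<Prod>e\<in>E. 1 + t e * prod x e) =
            prod x A * (\<Prod>e\<in>E'. 1 + t e * prod x e) +
            t e * (prod x (sym_diff A e) * (\<Prod>e\<in>E'. 1 + t e * prod x e))"
          using prod_spins_sym_diff[OF _ assms(1) A eV, symmetric] E by (simp add: algebra_simps)
      qed
      also have "\<dots> = 2 ^ card V * (m A + t e * m (sym_diff A e))"
        unfolding sum.distrib sum_distrib_left[symmetric] sum_m[OF A] sum_m[OF AeV]
        by (simp add: algebra_simps)
      also have "m A + t e * m (sym_diff A e) = m' A"
        using l[of A] l[of "sym_diff A e"] by (auto simp: m'_def e_def)
      finally show ?thesis .
    qed
    ultimately show ?thesis by blast
  qed
qed

lemma exp_spin_eq_cosh_tanh: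
  fixes \<theta> s :: real
  assumes "\<bar>s\<bar> = 1"
  shows "exp (\<theta> * s) = cosh \<theta> * (1 + tanh \<theta> * s)"
proof -
  have "s = 1 \<or> s = -1" using assms by auto
  moreover have "cosh \<theta> * tanh \<theta> = sinh \<theta>" by (simp add: tanh_def)
  ultimately show ?thesis
    using cosh_plus_sinh[of \<theta>] cosh_minus_sinh[of \<theta>] by (auto simp: algebra_simps)
qed

text \<open>
  The normalizing constant never has to be computed: a product weight with \<open>m {} = 1\<close> has total
  mass \<open>2 ^ card V\<close>, and probabilities sum to one.
\<close>
lemma ising_correlations:
  assumes "is_tree V E" "zero_field_ising V E P"
  shows "\<exists>m. forest_moments m \<and> (\<forall>A\<subseteq>V. (\<Sum>x\<in>spins V. prod x A * pmf P x) = m A)"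
proof -
  have V: "finite V" and E: "\<And>e. e \<in> E \<Longrightarrow> e \<subseteq> V \<and> card e = 2" "\<nexists>vs. graph_cycle E vs"
    using assms(1) by (auto simp: is_tree_def simple_graph_def)
  have "E \<subseteq> Pow V" using E(1) by auto
  then have finE: "finite E" using V finite_subset by blast
  obtain \<theta> where \<theta>: "\<And>x. x \<in> spins V \<Longrightarrow> pmf P x = exp (ising_energy E \<theta> x - log_partition V E \<theta>)"
    and supp: "set_pmf P \<subseteq> spins V"
    using assms(2) by (auto simp: zero_field_ising_def)
  have t: "\<bar>tanh (\<theta> e)\<bar> \<le> 1" for e
    using tanh_real_gt_neg1[of "\<theta> e"] tanh_real_lt_1[of "\<theta> e"] by simp
  let ?w = "\<lambda>x. \<Prod>e\<in>E. 1 + tanh (\<theta> e) * prod x e"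
  obtain m where m: "forest_moments m"
    and sum_m: "\<And>A. A \<subseteq> V \<Longrightarrow> (\<Sum>x\<in>spins V. prod x A * ?w x) = 2 ^ card V * m A"
    using forest_weight_moments[of V E "\<lambda>e. tanh (\<theta> e)", OF V finE E t] by auto
  define K where "K = (\<Prod>e\<in>E. cosh (\<theta> e)) / exp (log_partition V E \<theta>)"
  have pmf: "pmf P x = K * ?w x" if x: "x \<in> spins V" for x
  proof -
    have "exp (ising_energy E \<theta> x) = (\<Prod>e\<in>E. exp (\<theta> e * prod x e))"
      by (simp add: ising_energy_def exp_sum finE)
    also have "\<dots> = (\<Prod>e\<in>E. cosh (\<theta> e) * (1 + tanh (\<theta> e) * prod x e))"
      using E abs_prod_spins[OF x] by (intro prod.cong refl exp_spin_eq_cosh_tanh) auto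
    finally show ?thesis using \<theta>[OF x] by (simp add: exp_diff K_def prod.distrib)
  qed
  have moment: "(\<Sum>x\<in>spins V. prod x A * pmf P x) = K * 2 ^ card V * m A" if "A \<subseteq> V" for A
  proof -
    have "(\<Sum>x\<in>spins V. prod x A * pmf P x) = (\<Sum>x\<in>spins V. K * (prod x A * ?w x))"
      using pmf by (intro sum.cong) auto
    then show ?thesis using sum_m[OF that] by (simp flip: sum_distrib_left)
  qed
  have "K * 2 ^ card V = 1"
    using moment[of "{}"] forest_moments_empty[OF m] sum_pmf_eq_1[OF finite_spins[OF V] supp] by simp
  then show ?thesis using m moment by auto
qed

section \<open>Total variation distance and correlations\<close>

text \<open>
  Orthogonality of the characters of the cube. The sum is the expansion of \<open>\<Prod>(z\<^sub>i x\<^sub>i + 1)\<close>,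
  in which a coordinate with \<open>x\<^sub>i \<noteq> z\<^sub>i\<close> contributes a zero.
\<close>

lemma sum_Pow_prod_spins:
  assumes "finite S" "x \<in> spins S" "z \<in> spins S"
  shows "(\<Sum>A\<in>Pow S. prod z A * prod x A) = (if x = z then 2 ^ card S else 0)"
proof -
  have "(\<Sum>A\<in>Pow S. prod z A * prod x A) = (\<Prod>i\<in>S. z i * x i + 1)"
    using assms(1) by (subst prod_add) (auto simp: prod.distrib)
  also have "\<dots> = (if x = z then 2 ^ card S else 0)"
  proof (cases "x = z")
    case True
    then show ?thesis using spins_square[OF assms(3)] by simp
  next
    case False
    then obtain i where "i \<in> S" "x i \<noteq> z i"
      using assms by (metis PiE_ext spins_def)
    moreover have "x i \<in> {-1, 1}" "z i \<in> {-1, 1}"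
      using assms(2,3) \<open>i \<in> S\<close> by (auto simp: spins_def)
    ultimately have "z i * x i + 1 = 0" by auto
    then show ?thesis using False \<open>i \<in> S\<close> assms(1) by (auto intro: prod_zero)
  qed
  finally show ?thesis .
qed

lemma set_pmf_marginal:
  assumes "set_pmf P \<subseteq> spins V" "S \<subseteq> V"
  shows "set_pmf (marginal S P) \<subseteq> spins S"
  using assms by (fastforce simp: marginal_def spins_def)

lemma sum_prod_marginal:
  assumes "set_pmf P \<subseteq> spins V" "finite V" "S \<subseteq> V" "A \<subseteq> S"
  shows "(\<Sum>z\<in>spins S. prod z A * pmf (marginal S P) z) = (\<Sum>x\<in>spins V. prod x A * pmf P x)"
proof -
  have finS: "finite S" using assms(2,3) finite_subset by auto
  have "(\<Sum>z\<in>spins S. prod z A * pmf (marginal S P) z) = (\<integral>z. prod z A \<partial>marginal S P)"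
    using set_pmf_marginal[OF assms(1,3)]
    by (intro integral_measure_pmf_real[symmetric] finite_spins finS) auto
  also have "\<dots> = (\<integral>x. prod (restrict x S) A \<partial>P)"
    by (simp add: marginal_def)
  also have "\<dots> = (\<integral>x. prod x A \<partial>P)"
    using assms(4) by (intro Bochner_Integration.integral_cong refl prod.cong) auto
  also have "\<dots> = (\<Sum>x\<in>spins V. prod x A * pmf P x)"
    using assms(1) by (intro integral_measure_pmf_real finite_spins assms(2)) auto
  finally show ?thesis .
qed

lemma tv_dist_eq_sum:
  assumes "finite X" "set_pmf P \<subseteq> X" "set_pmf Q \<subseteq> X"
  shows "tv_dist P Q = (\<Sum>z\<in>X. \<bar>pmf P z - pmf Q z\<bar>) / 2"
proof -
  have pmf_eq_0: "pmf P z = 0" "pmf Q z = 0" if "z \<notin> X" for z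
    using assms(2,3) that by (auto simp: pmf_eq_0_set_pmf)
  have "(\<Sum>\<^sub>\<infinity>z. \<bar>pmf P z - pmf Q z\<bar>) = (\<Sum>\<^sub>\<infinity>z\<in>X. \<bar>pmf P z - pmf Q z\<bar>)"
    using pmf_eq_0 by (intro infsum_cong_neutral) auto
  then show ?thesis using assms(1) by (simp add: tv_dist_def)
qed

lemma moment_diff_le_tv_dist:
  assumes "finite S" "set_pmf P \<subseteq> spins S" "set_pmf Q \<subseteq> spins S"
  shows "\<bar>(\<Sum>z\<in>spins S. prod z S * pmf P z) - (\<Sum>z\<in>spins S. prod z S * pmf Q z)\<bar> \<le> 2 * tv_dist P Q"
proof -
  have "\<bar>(\<Sum>z\<in>spins S. prod z S * pmf P z) - (\<Sum>z\<in>spins S. prod z S * pmf Q z)\<bar>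
      \<le> (\<Sum>z\<in>spins S. \<bar>prod z S * (pmf P z - pmf Q z)\<bar>)"
    unfolding sum_subtractf[symmetric] right_diff_distrib[symmetric] by (rule sum_abs)
  also have "\<dots> = (\<Sum>z\<in>spins S. \<bar>pmf P z - pmf Q z\<bar>)"
    by (intro sum.cong refl) (simp add: abs_mult abs_prod_spins)
  also have "\<dots> = 2 * tv_dist P Q"
    using tv_dist_eq_sum[OF finite_spins[OF assms(1)] assms(2,3)] by simp
  finally show ?thesis .
qed

text \<open>
  Fourier inversion bounds each difference of point probabilities by \<open>2 ^ - card S\<close> times the sum
  of all differences of moments, and there are \<open>2 ^ card S\<close> points.
\<close>
lemma tv_dist_le_moment_diffs:
  assumes "finite S" "set_pmf P \<subseteq> spins S" "set_pmf Q \<subseteq> spins S"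
  shows "2 * tv_dist P Q \<le>
    (\<Sum>A\<in>Pow S. \<bar>(\<Sum>z\<in>spins S. prod z A * pmf P z) - (\<Sum>z\<in>spins S. prod z A * pmf Q z)\<bar>)"
proof -
  define d where "d z = pmf P z - pmf Q z" for z
  define D where "D A = (\<Sum>x\<in>spins S. prod x A * d x)" for A
  have D: "(\<Sum>z\<in>spins S. prod z A * pmf P z) - (\<Sum>z\<in>spins S. prod z A * pmf Q z) = D A" for A
    by (simp add: D_def d_def right_diff_distrib sum_subtractf)
  have card_spins: "card (spins S) = 2 ^ card S"
    using sum_spins_prod[OF assms(1), of "{}"] by simp
  have inversion: "2 ^ card S * d z = (\<Sum>A\<in>Pow S. prod z A * D A)" if z: "z \<in> spins S" for z
  proof -
    have "(\<Sum>A\<in>Pow S. prod z A * D A) =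
        (\<Sum>A\<in>Pow S. \<Sum>x\<in>spins S. prod z A * prod x A * d x)"
      by (simp add: D_def sum_distrib_left mult.assoc)
    also have "\<dots> = (\<Sum>x\<in>spins S. \<Sum>A\<in>Pow S. prod z A * prod x A * d x)"
      by (rule sum.swap)
    also have "\<dots> = (\<Sum>x\<in>spins S. (if x = z then 2 ^ card S else 0) * d x)"
      using sum_Pow_prod_spins[OF assms(1) _ z] by (simp flip: sum_distrib_right cong: sum.cong)
    also have "\<dots> = 2 ^ card S * d z"
      using z finite_spins[OF assms(1)] by (simp add: if_distrib[of "\<lambda>c. c * _"] cong: if_cong)
    finally show ?thesis ..
  qed
  have "2 ^ card S * (\<Sum>z\<in>spins S. \<bar>d z\<bar>) = (\<Sum>z\<in>spins S. \<bar>2 ^ card S * d z\<bar>)"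
    by (simp add: sum_distrib_left abs_mult)
  also have "\<dots> \<le> (\<Sum>z\<in>spins S. \<Sum>A\<in>Pow S. \<bar>D A\<bar>)"
  proof (intro sum_mono)
    fix z assume z: "z \<in> spins S"
    have "\<bar>2 ^ card S * d z\<bar> \<le> (\<Sum>A\<in>Pow S. \<bar>prod z A * D A\<bar>)"
      unfolding inversion[OF z] by (rule sum_abs)
    also have "\<dots> = (\<Sum>A\<in>Pow S. \<bar>D A\<bar>)"
      using abs_prod_spins[OF z] by (intro sum.cong) (auto simp: abs_mult)
    finally show "\<bar>2 ^ card S * d z\<bar> \<le> (\<Sum>A\<in>Pow S. \<bar>D A\<bar>)" .
  qed
  also have "\<dots> = 2 ^ card S * (\<Sum>A\<in>Pow S. \<bar>D A\<bar>)" using card_spins by simp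
  finally have "(\<Sum>z\<in>spins S. \<bar>d z\<bar>) \<le> (\<Sum>A\<in>Pow S. \<bar>D A\<bar>)" by simp
  then show ?thesis
    using tv_dist_eq_sum[OF finite_spins[OF assms(1)] assms(2,3)] by (simp add: D d_def)
qed

section \<open>Comparison of local total variation distances\<close>
theorem corollary1p2:
  fixes p :: nat
    and E E' :: "nat set set"
    and P Q :: "(nat \<Rightarrow> real) pmf"
    and \<eta> :: real
  assumes "p \<ge> 2"
    and "is_tree {1..p} E"
    and "is_tree {1..p} E'"
    and "zero_field_ising {1..p} E P"
    and "zero_field_ising {1..p} E' Q"
    and "local_tv {1..p} 2 P Q < \<eta>"
  shows "\<forall>k\<in>{1..p}. local_tv {1..p} k P Q < real k * 2 ^ k * \<eta>"
proof
  let ?V = "{1..p}"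
  let ?tv = "\<lambda>S. tv_dist (marginal S P) (marginal S Q)"
  define L where "L = local_tv ?V 2 P Q"
  obtain m where m: "forest_moments m"
    and P: "\<And>A. A \<subseteq> ?V \<Longrightarrow> (\<Sum>x\<in>spins ?V. prod x A * pmf P x) = m A"
    using ising_correlations assms(2,4) by metis
  obtain m' where m': "forest_moments m'"
    and Q: "\<And>A. A \<subseteq> ?V \<Longrightarrow> (\<Sum>x\<in>spins ?V. prod x A * pmf Q x) = m' A"
    using ising_correlations assms(3,5) by metis
  have supp: "set_pmf P \<subseteq> spins ?V" "set_pmf Q \<subseteq> spins ?V"
    using assms(4,5) by (auto simp: zero_field_ising_def)
  have marg: "(\<Sum>z\<in>spins S. prod z A * pmf (marginal S P) z) = m A"
      "(\<Sum>z\<in>spins S. prod z A * pmf (marginal S Q) z) = m' A" if "S \<subseteq> ?V" "A \<subseteq> S" for S A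
    using that sum_prod_marginal[OF supp(1)] sum_prod_marginal[OF supp(2)] P Q by auto
  have tv_le_L: "?tv S \<le> L" if "S \<subseteq> ?V" "card S = 2" for S
    unfolding L_def local_tv_def using that by (intro Max_ge) auto
  have close: "\<bar>m {u, v} - m' {u, v}\<bar> \<le> 2 * L" if "u \<in> ?V" "v \<in> ?V" "u \<noteq> v" for u v
  proof -
    have uv: "{u, v} \<subseteq> ?V" "card {u, v} = 2" using that by auto
    then show ?thesis
      using moment_diff_le_tv_dist[OF _ set_pmf_marginal[OF supp(1) uv(1)]
          set_pmf_marginal[OF supp(2) uv(1)]] marg[OF uv(1) subset_refl] tv_le_L[OF uv] by auto
  qed
  have "0 \<le> L" using close[of 1 2] assms(1) by simp
  fix k assume k: "k \<in> ?V"
  have "?tv S \<le> real k * 2 ^ k * L" if S: "S \<subseteq> ?V" "card S = k" for S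
  proof -
    have finS: "finite S" using S finite_subset by blast
    have "2 * ?tv S \<le> (\<Sum>A\<in>Pow S. \<bar>m A - m' A\<bar>)"
      using tv_dist_le_moment_diffs[OF finS set_pmf_marginal[OF supp(1) S(1)]
          set_pmf_marginal[OF supp(2) S(1)]] marg[OF S(1)] by simp
    also have "\<dots> \<le> (\<Sum>A\<in>Pow S. real k * (2 * L))"
    proof (intro sum_mono)
      fix A assume "A \<in> Pow S"
      then have A: "A \<subseteq> S" "finite A" "card A \<le> k"
        using finS S finite_subset card_mono by auto
      have "\<bar>m A - m' A\<bar> \<le> real (card A) * (2 * L)"
        using A S \<open>0 \<le> L\<close> by (intro forest_moments_diff_le[OF m m'] close) auto
      also have "\<dots> \<le> real k * (2 * L)" using A \<open>0 \<le> L\<close> by (intro mult_right_mono) auto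
      finally show "\<bar>m A - m' A\<bar> \<le> real k * (2 * L)" .
    qed
    also have "\<dots> = 2 * (real k * 2 ^ k * L)"
      using finS S by (simp add: card_Pow)
    finally show ?thesis by simp
  qed
  moreover have "real k * 2 ^ k * L < real k * 2 ^ k * \<eta>"
    using k assms(6) by (intro mult_strict_left_mono) (auto simp: L_def)
  moreover have "{S. S \<subseteq> ?V \<and> card S = k} \<noteq> {}"
    using k by (auto intro!: exI[of _ "{1..k}"])
  ultimately show "local_tv ?V k P Q < real k * 2 ^ k * \<eta>"
    unfolding local_tv_def by (subst Max_less_iff) (auto intro: le_less_trans)
qed

end
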